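(* Let $T\in\mathbb{B}(\mathcal{H})$ be a bounded linear operator on a complex Hilbert space $\mathcal{H}$ and let $\lambda\in[0,1]$. Then $$\omega\big(M_\lambda(T)\big)\le 2\int_0^1\omega\Big(\lambda tT+(1-\lambda)(1-t)T^D\Big)\,dt\le\frac12\Big(\lambda\,\omega(T)+(1-\lambda)\,\omega(T^D)+\omega\big(M_\lambda(T)\big)\Big).$$ In particular, $$\omega(\widehat{T})\le\int_0^1\omega\big(M_t(T)\big)\,dt\le\frac14\Big(\omega(T)+\omega(T^D)+2\omega(\widehat{T})\Big)\le\omega(T).$$
   Context: $\mathbb{B}(\mathcal{H})$ is the algebra of bounded linear operators on the complex Hilbert space $\mathcal{H}$, and $\omega(A)=\sup\{|\langle Ax,x\rangle|:\ x\in\mathcal{H},\ \|x\|=1\}$ is the numerical radius. $T=U|T|$ denotes the canonical polar decomposition: $|T|=(T^*T)^{1/2}$ and $U$ is the unique partial isometry with $T=U|T|$ and $\mathcal{N}(U)=\mathcal{N}(T)$ (null spaces). The Duggal transform of $T$ is $T^D:=|T|U$. For $\lambda\in[0,1]$ the $\lambda$-mean transform of $T$ is $M_\lambda(T):=\lambda T+(1-\lambda)T^D$, and $\widehat{T}:=M_{1/2}(T)=\frac12(T+T^D)$ is the mean transform. *)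

theory Defs
  imports "HOL-Analysis.Analysis"
begin

text \<open>
  Complex Hilbert spaces. The underlying real structure is that of the library class
  \<open>real_inner\<close>: real scaling is the restriction of the complex scaling, and the real inner
  product is the real part of the complex one. Hence \<open>norm x = sqrt (Re (cinner x x))\<close>, and
  positive definiteness of \<open>cinner\<close> is inherited from \<open>inner\<close>. The complex inner product is
  linear in its first argument.
\<close>

class chilbert_space = real_inner + complete_space +
  fixes scaleC :: "complex \<Rightarrow> 'a \<Rightarrow> 'a" (infixr "*\<^sub>C" 75)
    and cinner :: "'a \<Rightarrow> 'a \<Rightarrow> complex"
  assumes scaleC_add_right: "c *\<^sub>C (x + y) = c *\<^sub>C x + c *\<^sub>C y"
    and scaleC_add_left: "(c + d) *\<^sub>C x = c *\<^sub>C x + d *\<^sub>C x"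
    and scaleC_scaleC: "c *\<^sub>C (d *\<^sub>C x) = (c * d) *\<^sub>C x"
    and scaleC_of_real: "complex_of_real r *\<^sub>C x = r *\<^sub>R x"
    and cinner_commute: "cinner x y = cnj (cinner y x)"
    and cinner_add_left: "cinner (x + y) z = cinner x z + cinner y z"
    and cinner_scaleC_left: "cinner (c *\<^sub>C x) y = c * cinner x y"
    and Re_cinner: "Re (cinner x y) = inner x y"

instantiation complex :: chilbert_space
begin

definition scaleC_complex :: "complex \<Rightarrow> complex \<Rightarrow> complex"
  where "scaleC_complex c x = c * x"

definition cinner_complex :: "complex \<Rightarrow> complex \<Rightarrow> complex"
  where "cinner_complex x y = x * cnj y"

instance
  by standard
    (simp_all add: scaleC_complex_def cinner_complex_def algebra_simps scaleR_conv_of_real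
      inner_complex_def)

end

definition bounded_clinear :: "('a::chilbert_space \<Rightarrow> 'a) \<Rightarrow> bool"
  where "bounded_clinear A \<longleftrightarrow> bounded_linear A \<and> (\<forall>c x. A (c *\<^sub>C x) = c *\<^sub>C A x)"

text \<open>
  The supremum is taken in \<open>[0, \<infinity>)\<close>: inserting \<open>0\<close> matters only on the zero space, which has
  no unit vectors and where the numerical radius is \<open>0\<close>.
\<close>

definition numerical_radius :: "('a::chilbert_space \<Rightarrow> 'a) \<Rightarrow> real"
  where "numerical_radius A = Sup (insert 0 {cmod (cinner (A x) x) | x. norm x = 1})"

definition cadjoint :: "('a::chilbert_space \<Rightarrow> 'a) \<Rightarrow> 'a \<Rightarrow> 'a"
  where "cadjoint A = (THE B. bounded_clinear B \<and> (\<forall>x y. cinner (A x) y = cinner x (B y)))"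

definition positive_op :: "('a::chilbert_space \<Rightarrow> 'a) \<Rightarrow> bool"
  where "positive_op A \<longleftrightarrow> bounded_clinear A \<and> (\<forall>x. cinner (A x) x \<in> \<real>\<^sub>\<ge>\<^sub>0)"

definition sqrt_op :: "('a::chilbert_space \<Rightarrow> 'a) \<Rightarrow> 'a \<Rightarrow> 'a"
  where "sqrt_op A = (THE P. positive_op P \<and> P \<circ> P = A)"

definition abs_op :: "('a::chilbert_space \<Rightarrow> 'a) \<Rightarrow> 'a \<Rightarrow> 'a"
  where "abs_op T = sqrt_op (cadjoint T \<circ> T)"

definition null_space :: "('a::chilbert_space \<Rightarrow> 'a) \<Rightarrow> 'a set"
  where "null_space A = {x. A x = 0}"

text \<open>A partial isometry is isometric on the orthogonal complement of its null space.\<close>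

definition partial_isometry :: "('a::chilbert_space \<Rightarrow> 'a) \<Rightarrow> bool"
  where "partial_isometry U \<longleftrightarrow> bounded_clinear U \<and>
    (\<forall>x. (\<forall>y\<in>null_space U. cinner x y = 0) \<longrightarrow> norm (U x) = norm x)"

definition polar_factor :: "('a::chilbert_space \<Rightarrow> 'a) \<Rightarrow> 'a \<Rightarrow> 'a"
  where "polar_factor T =
    (THE U. partial_isometry U \<and> T = U \<circ> abs_op T \<and> null_space U = null_space T)"

definition duggal_transform :: "('a::chilbert_space \<Rightarrow> 'a) \<Rightarrow> 'a \<Rightarrow> 'a"
  where "duggal_transform T = abs_op T \<circ> polar_factor T"

definition lambda_mean_transform :: "real \<Rightarrow> ('a::chilbert_space \<Rightarrow> 'a) \<Rightarrow> 'a \<Rightarrow> 'a"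
  where "lambda_mean_transform l T = (\<lambda>x. l *\<^sub>R T x + (1 - l) *\<^sub>R duggal_transform T x)"

definition mean_transform :: "('a::chilbert_space \<Rightarrow> 'a) \<Rightarrow> 'a \<Rightarrow> 'a"
  where "mean_transform T = lambda_mean_transform (1/2) T"

end

theory Submission
  imports Defs
begin

text \<open>
  The numerical radius is a seminorm, so it is convex along the affine operator families
  \<open>t \<mapsto> \<lambda>tT + (1 - \<lambda>)(1 - t)T\<^sup>D\<close> and \<open>t \<mapsto> M\<^sub>t(T)\<close>, and the integral inequalities are the
  Hermite--Hadamard inequality and its refinement at the midpoint. The last inequality amounts to
  \<open>\<omega>(T\<^sup>D) \<le> \<omega>(T)\<close>, which holds because \<open>T\<^sup>D = U\<^sup>*TU\<close> with \<open>U\<close> a contraction. Everything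
  rests on the existence and uniqueness of the adjoint, of \<open>|T|\<close> and of the polar factor.
\<close>

text \<open>The adjoint, \<open>|T|\<close> and the polar factor are definite descriptions, so
  nothing can be said of them before existence and uniqueness are known. The geometry is done with
  the real \<open>inner\<close>; complex statements are recovered from commutation with
  \<open>\<i>\<close>. Two positive square roots are easily compared only if they commute, so the
  root built by iteration also carries the property of commuting with whatever commutes with its
  square. The relation between \<open>U\<close> and its adjoint enters only as
  \<open>inner (T x) (U y) = inner (|T| x) y\<close>, obtained by polarizing the isometry of
  \<open>U\<close> on the closure of the range of \<open>|T|\<close>. The operator families run over
  all real parameters because convexity on the open line yields continuity, hence integrability on
  the unit interval.\<close>

instance chilbert_space \<subseteq> banach ..

subsection \<open>Complex inner products\<close>

lemma cinner_scaleC_right: "cinner x (c *\<^sub>C y) = cnj c * cinner x y"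
  by (metis cinner_scaleC_left cinner_commute complex_cnj_mult)

lemma scaleC_minus_one: "(- 1) *\<^sub>C x = - (x::'a::chilbert_space)"
  using scaleC_of_real[of "-1" x] by simp

lemma scaleC_i_i: "\<i> *\<^sub>C (\<i> *\<^sub>C x) = - (x::'a::chilbert_space)"
  by (simp add: scaleC_scaleC scaleC_minus_one)

lemma scaleC_scaleR: "c *\<^sub>C (r *\<^sub>R x) = r *\<^sub>R (c *\<^sub>C (x::'a::chilbert_space))"
  by (simp flip: scaleC_of_real add: scaleC_scaleC mult.commute)

lemma scaleC_minus_right: "c *\<^sub>C (- x) = - (c *\<^sub>C (x::'a::chilbert_space))"
  using scaleC_scaleR[of c "-1" x] by simp

lemma scaleC_diff_right: "c *\<^sub>C (x - y) = c *\<^sub>C x - c *\<^sub>C (y::'a::chilbert_space)"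
  using scaleC_add_right[of c x "- y"] by (simp add: scaleC_minus_right)

lemma scaleC_zero_right: "c *\<^sub>C 0 = (0::'a::chilbert_space)"
  using scaleC_add_right[of c 0 "0::'a"] by simp

lemma scaleC_conv_scaleR: "c *\<^sub>C x = Re c *\<^sub>R x + Im c *\<^sub>R (\<i> *\<^sub>C (x::'a::chilbert_space))"
proof -
  have "c = complex_of_real (Re c) + complex_of_real (Im c) * \<i>"
    by (simp add: complex_eq_iff)
  then show ?thesis
    by (metis scaleC_add_left scaleC_of_real scaleC_scaleC)
qed

lemma inner_i_left: "inner (\<i> *\<^sub>C x) y = - Im (cinner x y)"
  by (simp flip: Re_cinner add: cinner_scaleC_left)

lemma inner_i_right: "inner x (\<i> *\<^sub>C y) = Im (cinner x y)"
  by (simp flip: Re_cinner add: cinner_scaleC_right)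

text \<open>Allows an identity for \<open>cinner\<close> to be proved by checking it for
  \<open>inner\<close>, once at \<open>y\<close> and once at
  \<open>\<i> *\<^sub>C y\<close>.\<close>

lemma cinner_conv_inner: "cinner x y = Complex (inner x y) (inner x (\<i> *\<^sub>C y))"
  by (simp add: complex_eq_iff Re_cinner inner_i_right)

lemma cinner_self: "cinner x x = complex_of_real ((norm x)\<^sup>2)"
proof -
  have "Im (cinner x x) = 0"
    using cinner_commute[of x x] by (metis Reals_cnj_iff complex_is_Real_iff)
  then show ?thesis
    by (simp add: complex_eq_iff Re_cinner power2_norm_eq_inner)
qed

lemma norm_scaleC: "norm (c *\<^sub>C x) = cmod c * norm (x::'a::chilbert_space)"
proof -
  have "complex_of_real ((norm (c *\<^sub>C x))\<^sup>2) = complex_of_real ((cmod c * norm x)\<^sup>2)"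
    unfolding power_mult_distrib of_real_mult complex_norm_square[of c] cinner_self[of x, symmetric]
      cinner_self[of "c *\<^sub>C x", symmetric]
    by (simp add: cinner_scaleC_left cinner_scaleC_right)
  then show ?thesis
    by (metis norm_ge_zero norm_mult of_real_eq_iff power2_eq_iff_nonneg zero_le_mult_iff)
qed

lemma bounded_linear_scaleC: "bounded_linear ((*\<^sub>C) c :: 'a::chilbert_space \<Rightarrow> 'a)"
  by (rule bounded_linear_intro[where K = "cmod c"])
    (simp_all add: scaleC_add_right scaleC_scaleR norm_scaleC mult.commute)

lemma cinner_Cauchy_Schwarz: "cmod (cinner x y) \<le> norm x * norm (y::'a::chilbert_space)"
proof (cases "cinner x y = 0")
  case False
  \<comment> \<open>A phase of modulus one that rotates the complex inner product onto the
    nonnegative real axis, where the real Cauchy-Schwarz inequality applies.\<close>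
  define c where "c = cnj (sgn (cinner x y))"
  have "c * cinner x y = complex_of_real (cmod (cinner x y))"
    using False complex_norm_square[of "cinner x y"]
    by (simp add: c_def sgn_eq power2_eq_square field_simps)
  then have "cmod (cinner x y) = inner (c *\<^sub>C x) y"
    by (simp flip: Re_cinner add: cinner_scaleC_left)
  also have "\<dots> \<le> norm (c *\<^sub>C x) * norm y"
    by (rule norm_cauchy_schwarz)
  finally show ?thesis
    using False by (simp add: norm_scaleC c_def norm_sgn)
qed simp

lemma bounded_clinear_imp_bounded_linear: "bounded_clinear A \<Longrightarrow> bounded_linear A"
  by (simp add: bounded_clinear_def)

lemma bounded_clinear_scaleC: "bounded_clinear A \<Longrightarrow> A (c *\<^sub>C x) = c *\<^sub>C A x"
  by (simp add: bounded_clinear_def)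

lemma bounded_clinearI:
  assumes "bounded_linear A" "\<And>x. A (\<i> *\<^sub>C x) = \<i> *\<^sub>C A x"
  shows "bounded_clinear A"
proof -
  interpret bounded_linear A by fact
  show ?thesis
    unfolding bounded_clinear_def
    by (metis assms add scaleC_conv_scaleR scaleR)
qed

lemma bounded_clinear_compose:
  "bounded_clinear A \<Longrightarrow> bounded_clinear B \<Longrightarrow> bounded_clinear (A \<circ> B)"
  by (simp add: bounded_clinear_def bounded_linear_compose o_def)

text \<open>Applying the real identity to \<open>\<i> *\<^sub>C x\<close> gives the imaginary parts,
  so a real adjoint of a complex-linear map is already its complex adjoint.\<close>

lemma cinner_adjointI:
  assumes "bounded_clinear A" "\<And>x y. inner (A x) y = inner x (B y)"
  shows "cinner (A x) y = cinner x (B y)"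
proof -
  have "inner (\<i> *\<^sub>C A x) y = inner (\<i> *\<^sub>C x) (B y)"
    using assms by (metis bounded_clinear_scaleC)
  then show ?thesis
    by (simp add: complex_eq_iff Re_cinner assms(2) inner_i_left)
qed

subsection \<open>Riesz representation and orthogonal decomposition\<close>

text \<open>The representing vector minimises \<open>\<parallel>x\<parallel>\<^sup>2 - 2 f x\<close> over \<open>M\<close>; minimising sequences are
  Cauchy by the parallelogram law.\<close>

lemma Riesz_on_closed_subspace:
  fixes f :: "'a::chilbert_space \<Rightarrow> real"
  assumes f: "bounded_linear f" and M: "subspace M" "closed M"
  obtains y where "y \<in> M" "\<And>x. x \<in> M \<Longrightarrow> f x = inner x y"
proof -
  interpret bounded_linear f by fact
  define J where "J x = (norm x)\<^sup>2 - 2 * f x" for x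
  obtain K where K: "\<And>x. norm (f x) \<le> norm x * K" using bounded by blast
  have J_ge: "J x \<ge> - K\<^sup>2" for x
  proof -
    have "f x \<le> norm x * K" using K[of x] by simp
    moreover have "0 \<le> (norm x - K)\<^sup>2" by simp
    ultimately show ?thesis by (simp add: J_def power2_eq_square algebra_simps)
  qed
  define m where "m = Inf (J ` M)"
  have bdd: "bdd_below (J ` M)" using J_ge by (intro bdd_belowI[of _ "- K\<^sup>2"]) auto
  have "0 \<in> M" using M by (simp add: subspace_0)
  have m_le: "m \<le> J x" if "x \<in> M" for x
    unfolding m_def using bdd that by (intro cInf_lower) auto
  have "\<exists>x\<in>M. J x < m + inverse (Suc n)" for n
  proof -
    have "m < m + inverse (Suc n)" by simp
    then show ?thesis
      unfolding m_def using \<open>0 \<in> M\<close> bdd by (subst (asm) cInf_less_iff) auto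
  qed
  then obtain X where X: "\<And>n. X n \<in> M" "\<And>n. J (X n) < m + inverse (Suc n)"
    by metis
  \<comment> \<open>The midpoint of \<open>x\<close> and \<open>y\<close> lies in \<open>M\<close>,
    so \<open>J\<close> is at least \<open>m\<close> there; the parallelogram law turns this into a
    bound on the distance.\<close>
  have par: "(norm (x - y))\<^sup>2 \<le> 2 * (J x - m) + 2 * (J y - m)" if "x \<in> M" "y \<in> M" for x y
  proof -
    have "(1/2) *\<^sub>R (x + y) \<in> M" using that M by (simp add: subspace_add subspace_scale)
    from m_le[OF this] have "4 * m \<le> (norm (x + y))\<^sup>2 - 4 * f x - 4 * f y"
      unfolding J_def scaleR add norm_scaleR power_mult_distrib
      by (simp add: power2_eq_square) (simp add: field_simps)
    moreover have "(norm (x + y))\<^sup>2 + (norm (x - y))\<^sup>2 = 2 * (norm x)\<^sup>2 + 2 * (norm y)\<^sup>2"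
      by (simp add: power2_norm_eq_inner inner_simps inner_commute)
    ultimately show ?thesis by (simp add: J_def)
  qed
  have "Cauchy X"
  proof (rule metric_CauchyI)
    fix e :: real assume "e > 0"
    \<comment> \<open>With both excesses of \<open>J\<close> over \<open>m\<close> below a quarter
      of \<open>e\<close> squared, \<open>par\<close> bounds the squared distance by
      \<open>e\<close> squared.\<close>
    then obtain N where N: "inverse (Suc N) < e\<^sup>2 / 4"
      using reals_Archimedean[of "e\<^sup>2 / 4"] by auto
    have "dist (X p) (X q) < e" if "p \<ge> N" "q \<ge> N" for p q
    proof -
      have "inverse (Suc p) \<le> inverse (Suc N)" "inverse (Suc q) \<le> inverse (Suc N)"
        using that by (simp_all add: field_simps)
      then have "(norm (X p - X q))\<^sup>2 < e\<^sup>2"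
        using par[OF X(1)[of p] X(1)[of q]] X(2)[of p] X(2)[of q] N by argo
      then show ?thesis
        using \<open>e > 0\<close> by (simp add: dist_norm power2_less_imp_less)
    qed
    then show "\<exists>N. \<forall>p\<ge>N. \<forall>q\<ge>N. dist (X p) (X q) < e" by blast
  qed
  then obtain y where y: "X \<longlonglongrightarrow> y" using Cauchy_convergent_iff convergent_def by blast
  have "y \<in> M" using M X(1) y by (metis closed_sequentially)
  have "(\<lambda>n. J (X n)) \<longlonglongrightarrow> J y"
    unfolding J_def by (intro tendsto_intros y tendsto)
  moreover have "(\<lambda>n. m + inverse (real (Suc n))) \<longlonglongrightarrow> m + 0"
    by (intro tendsto_intros LIMSEQ_inverse_real_of_nat)
  ultimately have "J y \<le> m"
    using X(2) by (intro LIMSEQ_le) (auto intro: less_imp_le)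
  have "f x = inner x y" if "x \<in> M" for x
  proof (rule ccontr)
    assume ne: "f x \<noteq> inner x y"
    define d where "d = f x - inner x y"
    have "d \<noteq> 0" using ne by (simp add: d_def)
    \<comment> \<open>Moving \<open>y\<close> along \<open>x\<close> changes \<open>J\<close> by a
      quadratic in \<open>t\<close> with linear term \<open>- 2 * t * d\<close>. This
      \<open>t\<close> makes the change negative, and the added 1 keeps the denominator positive
      even at \<open>x = 0\<close>.\<close>
    define t where "t = d / ((norm x)\<^sup>2 + 1)"
    have "y + t *\<^sub>R x \<in> M" using that \<open>y \<in> M\<close> M by (simp add: subspace_add subspace_scale)
    then have "J y \<le> J (y + t *\<^sub>R x)" using m_le \<open>J y \<le> m\<close> by fastforce
    also have "\<dots> = J y + t\<^sup>2 * (norm x)\<^sup>2 - 2 * t * d"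
      by (simp add: J_def d_def power2_norm_eq_inner add scaleR inner_simps inner_commute)
        (simp add: power2_eq_square algebra_simps)
    finally have "2 * t * d \<le> t\<^sup>2 * (norm x)\<^sup>2" by simp
    also have "\<dots> \<le> t\<^sup>2 * ((norm x)\<^sup>2 + 1)" by (simp add: mult_left_mono)
    also have "\<dots> = t * d"
      by (simp add: t_def power2_eq_square)
    finally have "t * d \<le> 0" by argo
    moreover have "t * d = d\<^sup>2 / ((norm x)\<^sup>2 + 1)" by (simp add: t_def power2_eq_square)
    moreover have "\<dots> > 0" using \<open>d \<noteq> 0\<close> by (simp add: add_nonneg_pos)
    ultimately show False by simp
  qed
  with \<open>y \<in> M\<close> that show ?thesis by blast
qed

lemma subspace_closure:
  fixes S :: "'a::real_normed_vector set"
  assumes "subspace S"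
  shows "subspace (closure S)"
proof (rule subspaceI)
  show "0 \<in> closure S"
    using subspace_0[OF assms] closure_subset by blast
next
  fix x y assume "x \<in> closure S" "y \<in> closure S"
  then obtain X Y where "\<And>n. X n \<in> S" "X \<longlonglongrightarrow> x" "\<And>n. Y n \<in> S" "Y \<longlonglongrightarrow> y"
    unfolding closure_sequential by blast
  then have "\<And>n. X n + Y n \<in> S" "(\<lambda>n. X n + Y n) \<longlonglongrightarrow> x + y"
    using assms by (auto intro: subspace_add tendsto_add)
  then show "x + y \<in> closure S" unfolding closure_sequential by (intro exI[of _ "\<lambda>n. X n + Y n"]) simp
next
  fix c x assume "x \<in> closure S"
  then obtain X where "\<And>n. X n \<in> S" "X \<longlonglongrightarrow> x"
    unfolding closure_sequential by blast
  then have "\<And>n. c *\<^sub>R X n \<in> S" "(\<lambda>n. c *\<^sub>R X n) \<longlonglongrightarrow> c *\<^sub>R x"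
    using assms by (auto intro: subspace_scale tendsto_scaleR)
  then show "c *\<^sub>R x \<in> closure S" unfolding closure_sequential by (intro exI[of _ "\<lambda>n. c *\<^sub>R X n"]) simp
qed

text \<open>The projection of \<open>x\<close> is the vector of \<open>M\<close> that represents the
  functional \<open>inner _ x\<close> restricted to \<open>M\<close>.\<close>

lemma orthogonal_decomposition:
  fixes x :: "'a::chilbert_space"
  assumes "subspace M" "closed M"
  obtains q where "q \<in> M" "\<And>y. y \<in> M \<Longrightarrow> inner y (x - q) = 0"
proof -
  obtain q where "q \<in> M" "\<And>y. y \<in> M \<Longrightarrow> inner y x = inner y q"
    using Riesz_on_closed_subspace[OF bounded_linear_inner_left assms, of x] by metis
  then show ?thesis using that by (simp add: inner_simps)
qed

subsection \<open>Adjoints\<close>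

text \<open>\<open>B y\<close> is the Riesz vector of the functional sending \<open>x\<close> to
  \<open>inner (A x) y\<close>; its linearity comes from the uniqueness of that vector.\<close>

lemma bounded_clinear_adjoint_ex:
  assumes A: "bounded_clinear A"
  obtains B where "bounded_clinear B" "\<And>x y. inner (A x) y = inner x (B y)"
proof -
  note lin = bounded_clinear_imp_bounded_linear[OF A]
  interpret A: bounded_linear A by (rule lin)
  have "\<exists>z. \<forall>x. inner (A x) y = inner x z" for y
    using Riesz_on_closed_subspace[OF bounded_linear_compose[OF bounded_linear_inner_left lin]
        subspace_UNIV closed_UNIV, of y]
    by (metis UNIV_I)
  then obtain B where B: "\<And>x y. inner (A x) y = inner x (B y)" by metis
  obtain K where K: "\<And>x. norm (A x) \<le> norm x * K" using A.bounded by blast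
  have "norm (B y) \<le> norm y * K" for y
  proof (cases "B y = 0")
    case True
    \<comment> \<open>The sign of \<open>K\<close> is not given, so nonnegativity is read off from
      the bound on \<open>A y\<close>.\<close>
    have "0 \<le> norm y * K" using order_trans[OF norm_ge_zero K[of y]] .
    then show ?thesis using True by simp
  next
    case False
    have "norm (B y) * norm (B y) = inner (A (B y)) y"
      using B[of "B y" y] by (simp flip: power2_norm_eq_inner power2_eq_square)
    also have "\<dots> \<le> norm (A (B y)) * norm y" by (rule norm_cauchy_schwarz)
    also have "\<dots> \<le> norm (B y) * K * norm y" by (intro mult_right_mono K) simp
    finally show ?thesis using False by (simp add: mult.commute mult.left_commute)
  qed
  moreover have "B (x + y) = B x + B y" "B (r *\<^sub>R x) = r *\<^sub>R B x" for x y r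
    by (subst vector_eq_ldot[symmetric], simp add: inner_simps flip: B)+
  ultimately have "bounded_linear B" by (intro bounded_linear_intro)
  moreover have "B (\<i> *\<^sub>C y) = \<i> *\<^sub>C B y" for y
  proof -
    have "inner x (B (\<i> *\<^sub>C y)) = inner x (\<i> *\<^sub>C B y)" for x
      by (metis B A cinner_adjointI inner_i_right)
    then show ?thesis by (metis vector_eq_ldot)
  qed
  ultimately show ?thesis using that B bounded_clinearI by blast
qed

lemma cadjoint_unique:
  assumes "bounded_clinear A" "bounded_clinear B" "\<And>x y. inner (A x) y = inner x (B y)"
  shows "cadjoint A = B"
  unfolding cadjoint_def
proof (rule the_equality)
  show "bounded_clinear B \<and> (\<forall>x y. cinner (A x) y = cinner x (B y))"
    using assms cinner_adjointI by blast
next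
  fix C assume C: "bounded_clinear C \<and> (\<forall>x y. cinner (A x) y = cinner x (C y))"
  have "inner x (C y) = inner x (B y)" for x y
    using C assms(3) by (metis Re_cinner)
  then show "C = B" by (metis ext vector_eq_ldot)
qed

lemma cadjoint:
  assumes "bounded_clinear A"
  shows bounded_clinear_cadjoint: "bounded_clinear (cadjoint A)"
    and inner_cadjoint_right: "inner x (cadjoint A y) = inner (A x) y"
  using bounded_clinear_adjoint_ex[OF assms] cadjoint_unique[OF assms] by metis+

subsection \<open>Positive square roots\<close>

text \<open>The fixed point \<open>X = (B + X\<^sup>2) / 2\<close>, that is \<open>(1 - X)\<^sup>2 = 1 - B\<close>, is the norm limit
  of the iteration from \<open>0\<close>: its increments are dominated by those of the scalar iteration
  \<open>x \<mapsto> (1 + x\<^sup>2) / 2\<close>, which increases and stays below \<open>1\<close>.\<close>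

interpretation blinfun_compose: bounded_bilinear blinfun_compose
  by (rule bounded_bilinear_blinfun_compose)

lemma quadratic_fixed_point:
  fixes B :: "'b::banach \<Rightarrow>\<^sub>L 'b"
  assumes B: "norm B \<le> 1"
  shows "\<exists>X. norm X \<le> 1 \<and> 2 *\<^sub>R X = B + (X o\<^sub>L X) \<and>
    (\<forall>S. closed S \<longrightarrow> 0 \<in> S \<longrightarrow> (\<forall>Y\<in>S. (1/2) *\<^sub>R (B + (Y o\<^sub>L Y)) \<in> S) \<longrightarrow> X \<in> S)"
proof -
  define F where "F Y = (1/2) *\<^sub>R (B + (Y o\<^sub>L Y))" for Y
  define g :: "real \<Rightarrow> real" where "g y = (1 + y * y) / 2" for y
  define X where "X n = (F ^^ n) 0" for n
  define x where "x n = (g ^^ n) 0" for n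
  have X_Suc: "X (Suc n) = F (X n)" and x_Suc: "x (Suc n) = g (x n)" for n
    by (simp_all add: X_def x_def)
  have "X 0 = 0" "x 0 = 0" by (simp_all add: X_def x_def)
  have x_bounds: "0 \<le> x n \<and> x n \<le> 1" for n
  proof (induction n)
    case (Suc n)
    then have "x n * x n \<le> 1" by (simp add: mult_le_one)
    then show ?case by (simp add: x_Suc g_def)
  qed (simp add: \<open>x 0 = 0\<close>)
  have X_le: "norm (X n) \<le> x n" for n
  proof (induction n)
    case (Suc n)
    have "norm (X n o\<^sub>L X n) \<le> x n * x n"
      using Suc by (intro order_trans[OF norm_blinfun_compose] mult_mono) (auto simp: x_bounds)
    then have "norm (B + (X n o\<^sub>L X n)) \<le> 1 + x n * x n"
      using B norm_triangle_ineq[of B "X n o\<^sub>L X n"] by linarith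
    then show ?case by (simp add: X_Suc x_Suc F_def g_def)
  qed (simp add: \<open>X 0 = 0\<close> \<open>x 0 = 0\<close>)
  have inc: "norm (X (Suc n) - X n) \<le> x (Suc n) - x n" for n
  proof (induction n)
    case 0
    then show ?case using X_le[of 1] by (simp add: \<open>X 0 = 0\<close> \<open>x 0 = 0\<close>)
  next
    case (Suc n)
    let ?D = "X (Suc n) - X n" and ?d = "x (Suc n) - x n"
    \<comment> \<open>A difference of squares split without assuming commutativity; the scalar
      increments satisfy the same recursion, so domination passes to the next step.\<close>
    have "X (Suc (Suc n)) - X (Suc n) = (1/2) *\<^sub>R ((X (Suc n) o\<^sub>L ?D) + (?D o\<^sub>L X n))"
      unfolding X_Suc[of "Suc n"] F_def
      by (subst X_Suc[of n]) (simp add: F_def blinfun_compose.diff_left blinfun_compose.diff_right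
          algebra_simps flip: scaleR_diff_right)
    moreover have "0 \<le> ?d" using order_trans[OF norm_ge_zero Suc] .
    then have "norm ((X (Suc n) o\<^sub>L ?D) + (?D o\<^sub>L X n)) \<le> x (Suc n) * ?d + ?d * x n"
      using Suc X_le[of n] X_le[of "Suc n"] x_bounds[of n] x_bounds[of "Suc n"]
      by (intro order_trans[OF norm_triangle_ineq] add_mono
          order_trans[OF norm_blinfun_compose] mult_mono)
        auto
    moreover have "x (Suc (Suc n)) - x (Suc n) = (x (Suc n) * ?d + ?d * x n) / 2"
      unfolding x_Suc[of "Suc n"] by (subst (2) x_Suc) (simp add: g_def field_simps)
    ultimately show ?case by simp
  qed
  have "incseq x"
    using inc by (intro incseq_SucI) (metis diff_ge_0_iff_ge norm_ge_zero order_trans)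
  then have "convergent x"
    using x_bounds by (metis convergentI incseq_convergent)
  then have "summable (\<lambda>n. x (Suc n) - x n)"
    using telescope_summable convergent_LIMSEQ_iff by blast
  then have "summable (\<lambda>n. X (Suc n) - X n)"
    by (rule summable_comparison_test') (rule inc)
  then have "convergent X"
    using summable_LIMSEQ[of "\<lambda>n. X (Suc n) - X n"]
    by (auto simp: sum_lessThan_telescope \<open>X 0 = 0\<close> convergent_def)
  then obtain L where L: "X \<longlonglongrightarrow> L" by (auto simp: convergent_def)
  have "norm L \<le> 1"
    using X_le x_bounds by (intro LIMSEQ_le_const2[OF tendsto_norm[OF L]]) (meson order_trans)
  moreover have "2 *\<^sub>R L = B + (L o\<^sub>L L)"
  proof -
    have "(\<lambda>n. X (Suc n)) \<longlonglongrightarrow> F L"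
      unfolding X_Suc F_def by (intro tendsto_intros blinfun_compose.tendsto L)
    then have "L = F L" using L LIMSEQ_Suc LIMSEQ_unique by blast
    then have "2 *\<^sub>R L = 2 *\<^sub>R F L" by simp
    then show ?thesis by (simp add: F_def)
  qed
  \<comment> \<open>A transfer principle: the limit inherits every closed property that holds at 0
    and survives the iteration. Symmetry, complex linearity and commutation of the root are all
    obtained this way.\<close>
  moreover have "L \<in> S" if S: "closed S" "0 \<in> S" "\<And>Y. Y \<in> S \<Longrightarrow> (1/2) *\<^sub>R (B + (Y o\<^sub>L Y)) \<in> S" for S
  proof -
    have "X n \<in> S" for n
      by (induction n) (simp_all add: \<open>X 0 = 0\<close> X_Suc F_def S)
    with S(1) L show ?thesis by (metis closed_sequentially)
  qed
  ultimately show ?thesis by blast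
qed

lemma positive_op_iff:
  "positive_op A \<longleftrightarrow> bounded_clinear A \<and> (\<forall>x y. inner (A x) y = inner x (A y)) \<and> (\<forall>x. inner (A x) x \<ge> 0)"
proof (intro iffI conjI allI)
  assume A: "positive_op A"
  then show clin: "bounded_clinear A" by (simp add: positive_op_def)
  interpret bounded_linear A by (rule bounded_clinear_imp_bounded_linear[OF clin])
  have nonneg: "cinner (A x) x \<in> \<real>\<^sub>\<ge>\<^sub>0" for x using A by (simp add: positive_op_def)
  then show "inner (A x) x \<ge> 0" for x
    by (metis Re_cinner complex_nonneg_Reals_iff)
  \<comment> \<open>This is the vanishing imaginary part of \<open>cinner (A x) x\<close>.
    Polarizing it at \<open>x + y\<close> and then replacing \<open>x\<close> by
    \<open>\<i> *\<^sub>C x\<close> yields symmetry.\<close>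
  have alt: "inner (A (\<i> *\<^sub>C x)) x = 0" for x
    using nonneg[of x]
    by (simp add: bounded_clinear_scaleC[OF clin] inner_i_left complex_nonneg_Reals_iff)
  fix x y
  have "inner (A (\<i> *\<^sub>C x)) y + inner (A (\<i> *\<^sub>C y)) x = 0" for x y
    using alt[of "x + y"] alt[of x] alt[of y] by (simp add: scaleC_add_right add inner_simps)
  from this[of "\<i> *\<^sub>C x" y] show "inner (A x) y = inner x (A y)"
    by (simp add: bounded_clinear_scaleC[OF clin] scaleC_i_i inner_i_left inner_i_right
        cinner_scaleC_left cinner_scaleC_right neg Re_cinner inner_commute)
next
  assume A: "bounded_clinear A \<and> (\<forall>x y. inner (A x) y = inner x (A y)) \<and> (\<forall>x. inner (A x) x \<ge> 0)"
  have "Im (cinner (A x) x) = 0" for x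
    using A cinner_adjointI[of A A x x] cinner_commute[of "A x" x]
    by (metis Reals_cnj_iff complex_is_Real_iff)
  with A show "positive_op A"
    unfolding positive_op_def complex_nonneg_Reals_iff Re_cinner by blast
qed

text \<open>Otherwise a small step from \<open>y\<close> in the direction \<open>- A y\<close> would
  make the quadratic form negative, its first-order term being \<open>- 2 * t\<close> times the
  squared norm of \<open>A y\<close>.\<close>

lemma positive_op_inner_zero:
  assumes A: "positive_op A" and "inner (A y) y = 0"
  shows "A y = 0"
proof (rule ccontr)
  assume "A y \<noteq> 0"
  from A have clin: "bounded_clinear A" and sym: "\<And>x y. inner (A x) y = inner x (A y)"
    and pos: "\<And>x. inner (A x) x \<ge> 0"
    by (auto simp: positive_op_iff)
  interpret bounded_linear A by (rule bounded_clinear_imp_bounded_linear[OF clin])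
  define z where "z = A y"
  define c where "c = inner (A z) z + 1"
  define t where "t = (norm z)\<^sup>2 / c"
  have "c > 0" using pos[of z] by (simp add: c_def)
  have "(norm z)\<^sup>2 > 0" using \<open>A y \<noteq> 0\<close> by (simp add: z_def)
  then have "t > 0" using \<open>c > 0\<close> by (simp add: t_def)
  have "0 \<le> inner (A (y - t *\<^sub>R z)) (y - t *\<^sub>R z)" by (rule pos)
  also have "\<dots> = t\<^sup>2 * inner (A z) z - 2 * t * (norm z)\<^sup>2"
    using assms(2) sym[of z y]
    by (simp add: diff scaleR inner_simps z_def[symmetric] inner_commute power2_norm_eq_inner)
      (simp add: power2_eq_square algebra_simps)
  also have "\<dots> \<le> t\<^sup>2 * c - 2 * t * (norm z)\<^sup>2" by (simp add: c_def mult_left_mono)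
  also have "t\<^sup>2 * c = t * (norm z)\<^sup>2" using \<open>c > 0\<close> by (simp add: t_def power2_eq_square)
  finally have "t * (norm z)\<^sup>2 \<le> 0" by simp
  with \<open>t > 0\<close> \<open>(norm z)\<^sup>2 > 0\<close> show False by (simp add: mult_le_0_iff)
qed

text \<open>Commutation gives \<open>(P + Q) (P - Q) = 0\<close>. For \<open>y = P x - Q x\<close>
  the two nonnegative forms then sum to zero, so \<open>P\<close> and \<open>Q\<close> both kill
  \<open>y\<close>, and by symmetry \<open>inner y y = 0\<close>.\<close>

lemma positive_op_commuting_roots_eq:
  assumes P: "positive_op P" and Q: "positive_op Q"
    and sq: "P \<circ> P = Q \<circ> Q" and comm: "P \<circ> Q = Q \<circ> P"
  shows "P = Q"
proof
  fix x
  from P Q have clin: "bounded_clinear P" "bounded_clinear Q"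
    and sym: "\<And>x y. inner (P x) y = inner x (P y)" "\<And>x y. inner (Q x) y = inner x (Q y)"
    and pos: "\<And>x. inner (P x) x \<ge> 0" "\<And>x. inner (Q x) x \<ge> 0"
    by (auto simp: positive_op_iff)
  interpret P: bounded_linear P by (rule bounded_clinear_imp_bounded_linear[OF clin(1)])
  interpret Q: bounded_linear Q by (rule bounded_clinear_imp_bounded_linear[OF clin(2)])
  have sq': "P (P z) = Q (Q z)" and comm': "P (Q z) = Q (P z)" for z
    using sq comm by (simp_all add: fun_eq_iff)
  define y where "y = P x - Q x"
  have "P y + Q y = 0" by (simp add: y_def P.diff Q.diff sq' comm')
  then have "inner (P y) y + inner (Q y) y = 0" by (metis inner_add_left inner_zero_left)
  then have "inner (P y) y = 0" "inner (Q y) y = 0" using pos[of y] by linarith+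
  then have "P y = 0" "Q y = 0" using P Q positive_op_inner_zero by blast+
  moreover have "inner y y = inner x (P y) - inner x (Q y)"
    by (subst (1) y_def) (simp add: inner_diff_left sym)
  ultimately have "inner y y = 0" by simp
  then show "P x = Q x" by (simp add: y_def)
qed

text \<open>After rescaling, \<open>B = 1 - c A\<close> is a contraction, and a fixed point
  \<open>X\<close> of the quadratic iteration satisfies \<open>(1 - X)^2 = c A\<close>; hence
  \<open>P = K (1 - X)\<close>. The commutation clause serves the uniqueness of the root.\<close>

lemma positive_op_adjoint_product_root:
  assumes T: "bounded_clinear T"
  obtains P where "positive_op P" "P \<circ> P = cadjoint T \<circ> T"
    "\<And>Q. bounded_linear Q \<Longrightarrow> Q \<circ> (cadjoint T \<circ> T) = cadjoint T \<circ> T \<circ> Q \<Longrightarrow> P \<circ> Q = Q \<circ> P"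
proof -
  define A where "A = cadjoint T \<circ> T"
  have clin_A: "bounded_clinear A"
    by (simp add: A_def T bounded_clinear_compose bounded_clinear_cadjoint)
  have lin_A: "bounded_linear A" by (rule bounded_clinear_imp_bounded_linear[OF clin_A])
  obtain K where "K > 0" and K: "\<And>x. norm (T x) \<le> norm x * K"
    using bounded_linear.pos_bounded[OF bounded_clinear_imp_bounded_linear[OF T]] by blast
  have A_sym: "inner (A x) y = inner x (A y)" for x y
    using inner_cadjoint_right[OF T] by (metis A_def comp_apply inner_commute)
  have A_self: "inner x (A x) = (norm (T x))\<^sup>2" for x
    using inner_cadjoint_right[OF T] by (simp add: A_def power2_norm_eq_inner)
  have A_le: "norm (A x) \<le> K * norm (T x)" for x
  proof (cases "A x = 0")
    case True
    then show ?thesis using \<open>K > 0\<close> by simp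
  next
    case False
    have "norm (A x) * norm (A x) = inner (T (A x)) (T x)"
      using inner_cadjoint_right[OF T, of "A x" "T x"]
      by (simp add: A_def flip: power2_norm_eq_inner power2_eq_square)
    also have "\<dots> \<le> norm (T (A x)) * norm (T x)" by (rule norm_cauchy_schwarz)
    also have "\<dots> \<le> norm (A x) * K * norm (T x)" by (intro mult_right_mono K) simp
    finally show ?thesis using False by simp
  qed
  \<comment> \<open>Chosen so that, by \<open>A_le\<close>, the quadratic term of the squared norm
    of \<open>B x\<close> absorbs only half of the negative linear term.\<close>
  define c where "c = 1 / K\<^sup>2"
  have "c > 0" using \<open>K > 0\<close> by (simp add: c_def)
  define B where "B = Blinfun (\<lambda>x. x - c *\<^sub>R A x)"
  have B: "blinfun_apply B = (\<lambda>x. x - c *\<^sub>R A x)"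
    unfolding B_def using lin_A
    by (intro bounded_linear_Blinfun_apply bounded_linear_sub bounded_linear_ident
        bounded_linear_const_scaleR)
  have "norm B \<le> 1"
  proof (rule norm_blinfun_bound)
    fix x
    have "(norm (B x))\<^sup>2 = (norm x)\<^sup>2 - 2 * c * (norm (T x))\<^sup>2 + c\<^sup>2 * (norm (A x))\<^sup>2"
      unfolding A_self[symmetric] B
      by (simp add: power2_norm_eq_inner inner_simps inner_commute[of "A x" x])
        (simp add: power2_eq_square algebra_simps)
    also have "c\<^sup>2 * (norm (A x))\<^sup>2 \<le> c\<^sup>2 * (K * norm (T x))\<^sup>2"
      by (intro mult_left_mono power_mono A_le) auto
    also have "c\<^sup>2 * (K * norm (T x))\<^sup>2 = c * (norm (T x))\<^sup>2"
      using \<open>K > 0\<close> by (simp add: c_def power_mult_distrib field_simps power2_eq_square)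
    finally have "(norm (B x))\<^sup>2 \<le> (norm x)\<^sup>2 - c * (norm (T x))\<^sup>2" by simp
    also have "\<dots> \<le> (norm x)\<^sup>2" using \<open>c > 0\<close> by simp
    finally have "norm (B x) \<le> norm x" by (rule power2_le_imp_le) simp
    then show "norm (B x) \<le> 1 * norm x" by simp
  qed simp
  then obtain X where "norm X \<le> 1" and X: "2 *\<^sub>R X = B + (X o\<^sub>L X)"
    and X_in: "\<And>S. closed S \<Longrightarrow> 0 \<in> S \<Longrightarrow> (\<And>Y. Y \<in> S \<Longrightarrow> (1/2) *\<^sub>R (B + (Y o\<^sub>L Y)) \<in> S) \<Longrightarrow> X \<in> S"
    using quadratic_fixed_point[of B] by meson
  have "X \<in> {Y. \<forall>x y. inner (blinfun_apply Y x) y = inner x (blinfun_apply Y y)}"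
  proof (rule X_in)
    show "closed {Y. \<forall>x y. inner (blinfun_apply Y x) y = inner x (blinfun_apply Y y)}"
      by (intro closed_Collect_all closed_Collect_eq continuous_intros)
  qed (simp_all add: B blinfun.bilinear_simps inner_simps A_sym)
  then have X_sym: "inner (X x) y = inner x (X y)" for x y by blast
  have "X \<in> {Y. \<forall>x. blinfun_apply Y (\<i> *\<^sub>C x) = \<i> *\<^sub>C blinfun_apply Y x}"
  proof (rule X_in)
    show "closed {Y. \<forall>x. blinfun_apply Y (\<i> *\<^sub>C x) = \<i> *\<^sub>C blinfun_apply Y x}"
      by (intro closed_Collect_all closed_Collect_eq continuous_intros
          bounded_linear.continuous_on[OF bounded_linear_scaleC])
  qed (simp_all add: B blinfun.bilinear_simps bounded_clinear_scaleC[OF clin_A] scaleC_zero_right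
      scaleC_scaleR scaleC_add_right scaleC_diff_right)
  then have X_i: "X (\<i> *\<^sub>C x) = \<i> *\<^sub>C X x" for x by blast
  have X_comm: "X (Q x) = Q (X x)" if Q: "bounded_linear Q" and QA: "Q \<circ> A = A \<circ> Q" for Q x
  proof -
    interpret Q: bounded_linear Q by fact
    have AQ: "A (Q x) = Q (A x)" for x using QA by (simp add: fun_eq_iff)
    have "X \<in> {Y. \<forall>x. blinfun_apply Y (Q x) = Q (blinfun_apply Y x)}"
    proof (rule X_in)
      show "closed {Y. \<forall>x. blinfun_apply Y (Q x) = Q (blinfun_apply Y x)}"
        by (intro closed_Collect_all closed_Collect_eq continuous_intros Q.continuous_on)
    qed (simp_all add: B blinfun.bilinear_simps Q.zero Q.scaleR Q.add Q.diff AQ)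
    then show ?thesis by blast
  qed
  define P where "P x = K *\<^sub>R (x - X x)" for x
  have "bounded_linear P"
    unfolding P_def
    by (intro bounded_linear_const_scaleR bounded_linear_sub bounded_linear_ident
        blinfun.bounded_linear_right)
  then have "bounded_clinear P"
    by (rule bounded_clinearI) (simp add: P_def X_i scaleC_scaleR scaleC_diff_right)
  moreover have "inner (P x) y = inner x (P y)" for x y
    by (simp add: P_def inner_simps X_sym)
  moreover have "inner (P x) x \<ge> 0" for x
  proof -
    have "inner (X x) x \<le> norm (X x) * norm x" by (rule norm_cauchy_schwarz)
    also have "\<dots> \<le> norm x * norm x"
      using mult_right_mono[OF \<open>norm X \<le> 1\<close> norm_ge_zero[of x]] norm_blinfun[of X x]
      by (intro mult_right_mono) auto
    finally have "inner (X x) x \<le> inner x x"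
      by (metis power2_eq_square power2_norm_eq_inner)
    then show ?thesis
      using \<open>K > 0\<close> by (simp add: P_def inner_diff_left)
  qed
  ultimately have "positive_op P" by (simp add: positive_op_iff)
  moreover have "P \<circ> P = A"
  proof
    fix x
    have "2 *\<^sub>R X x = B x + X (X x)"
      using arg_cong[OF X, of "\<lambda>Y. blinfun_apply Y x"] by (simp add: blinfun.bilinear_simps)
    then have "x - 2 *\<^sub>R X x + X (X x) = c *\<^sub>R A x" by (simp add: B)
    moreover have "P (P x) = K\<^sup>2 *\<^sub>R (x - 2 *\<^sub>R X x + X (X x))"
      by (simp add: P_def blinfun.bilinear_simps power2_eq_square algebra_simps scaleR_2)
    ultimately show "(P \<circ> P) x = A x" using \<open>K > 0\<close> by (simp add: c_def)
  qed
  moreover have "P \<circ> Q = Q \<circ> P" if "bounded_linear Q" "Q \<circ> A = A \<circ> Q" for Q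
    using X_comm[OF that] that(1)
    by (simp add: fun_eq_iff P_def bounded_linear.linear linear_scale linear_diff)
  ultimately show ?thesis using that by (simp add: A_def)
qed

lemma sqrt_op_adjoint_product:
  assumes "bounded_clinear T"
  shows "positive_op (sqrt_op (cadjoint T \<circ> T))"
    and "sqrt_op (cadjoint T \<circ> T) \<circ> sqrt_op (cadjoint T \<circ> T) = cadjoint T \<circ> T"
proof -
  obtain P where P: "positive_op P" "P \<circ> P = cadjoint T \<circ> T"
    and comm: "\<And>Q. bounded_linear Q \<Longrightarrow> Q \<circ> (cadjoint T \<circ> T) = cadjoint T \<circ> T \<circ> Q \<Longrightarrow> P \<circ> Q = Q \<circ> P"
    using positive_op_adjoint_product_root[OF assms] by blast
  have uniq: "Q = P" if Q: "positive_op Q" "Q \<circ> Q = cadjoint T \<circ> T" for Q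
  proof -
    have "bounded_linear Q"
      using Q by (simp add: positive_op_def bounded_clinear_def)
    \<comment> \<open>Any competing root commutes with its own square, so the constructed root
      commutes with it.\<close>
    moreover have "Q \<circ> (cadjoint T \<circ> T) = cadjoint T \<circ> T \<circ> Q"
      unfolding Q(2)[symmetric] by (simp add: comp_assoc)
    ultimately have "P \<circ> Q = Q \<circ> P" by (rule comm)
    then show ?thesis using positive_op_commuting_roots_eq[OF P(1) Q(1)] P(2) Q(2) by simp
  qed
  have "sqrt_op (cadjoint T \<circ> T) = P"
    unfolding sqrt_op_def using P uniq by (blast intro: the_equality)
  with P show "positive_op (sqrt_op (cadjoint T \<circ> T))"
    "sqrt_op (cadjoint T \<circ> T) \<circ> sqrt_op (cadjoint T \<circ> T) = cadjoint T \<circ> T"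
    by simp_all
qed

lemma positive_op_abs_op: "bounded_clinear T \<Longrightarrow> positive_op (abs_op T)"
  by (simp add: abs_op_def sqrt_op_adjoint_product)

text \<open>Makes the assignment of \<open>T x\<close> to \<open>abs_op T x\<close> well defined and
  isometric, which is the seed of the polar factor.\<close>

lemma norm_abs_op:
  assumes "bounded_clinear T"
  shows "norm (abs_op T x) = norm (T x)"
proof -
  have "inner (abs_op T x) (abs_op T x) = inner x ((abs_op T \<circ> abs_op T) x)"
    using positive_op_abs_op[OF assms] by (simp add: positive_op_iff)
  also have "\<dots> = inner (T x) (T x)"
    unfolding abs_op_def sqrt_op_adjoint_product(2)[OF assms]
    by (simp add: inner_cadjoint_right[OF assms])
  finally show ?thesis by (simp add: norm_eq)
qed

subsection \<open>Polar decomposition\<close>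

lemma abs_op_eq_zero_iff: "bounded_clinear T \<Longrightarrow> abs_op T x = 0 \<longleftrightarrow> T x = 0"
  using norm_abs_op[of T x] by (metis norm_eq_zero)

lemma inner_closure_range_kernel:
  assumes P: "\<And>x y. inner (P x) y = inner x (P y)" and q: "q \<in> closure (range P)" and n: "P n = 0"
  shows "inner q n = 0"
proof -
  have "range P \<subseteq> {q. inner q n = 0}" using P n by auto
  moreover have "closed {q. inner q n = 0}"
    by (intro closed_Collect_eq continuous_intros)
  ultimately show ?thesis using q closure_minimal by blast
qed

text \<open>For symmetric \<open>P\<close> a vector orthogonal to the range lies in the kernel, so
  the residual of the projection is the kernel part.\<close>

lemma closure_range_kernel_decomposition:
  fixes P :: "'a::chilbert_space \<Rightarrow> 'a"
  assumes P: "bounded_linear P" "\<And>x y. inner (P x) y = inner x (P y)"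
  obtains q n where "q \<in> closure (range P)" "P n = 0" "x = q + n"
proof -
  interpret bounded_linear P by (rule P(1))
  have "subspace (closure (range P))"
    by (intro subspace_closure linear_subspace_image linear_axioms subspace_UNIV)
  then obtain q where q: "q \<in> closure (range P)" "\<And>y. y \<in> closure (range P) \<Longrightarrow> inner y (x - q) = 0"
    using orthogonal_decomposition[OF _ closed_closure, of "range P" x] by blast
  have "inner y (P (x - q)) = 0" for y
    using q(2)[OF subsetD[OF closure_subset rangeI], of y] by (simp add: P(2))
  then have "P (x - q) = 0" by (metis inner_eq_zero_iff)
  with q(1) that[of q "x - q"] show ?thesis by simp
qed

text \<open>On the closure of the range of \<open>|T|\<close>, \<open>U\<close> is obtained as the limit of \<open>T y\<^sub>k\<close> along any
  sequence with \<open>|T| y\<^sub>k \<rightarrow> x\<close>; the relation \<open>G\<close> below is the graph of \<open>U\<close>.\<close>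

lemma polar_factor_ex:
  assumes T: "bounded_clinear T"
  shows "\<exists>U. partial_isometry U \<and> T = U \<circ> abs_op T \<and> null_space U = null_space T"
proof -
  define P where "P = abs_op T"
  have clin: "bounded_clinear P" and P_sym: "\<And>x y. inner (P x) y = inner x (P y)"
    using positive_op_abs_op[OF T] by (auto simp: positive_op_iff P_def)
  have norm_P: "norm (P x) = norm (T x)" for x
    by (simp add: P_def norm_abs_op[OF T])
  interpret P: bounded_linear P by (rule bounded_clinear_imp_bounded_linear[OF clin])
  interpret T: bounded_linear T by (rule bounded_clinear_imp_bounded_linear[OF T])
  \<comment> \<open>Here \<open>n\<close> is the kernel part of \<open>x\<close>. A relation makes
    additivity and scaling provable before the choice of \<open>Y\<close> is known to be
    immaterial.\<close>
  define G where "G x u \<longleftrightarrow> (\<exists>Y n. (\<lambda>k. P (Y k)) \<longlonglongrightarrow> x - n \<and> P n = 0 \<and> (\<lambda>k. T (Y k)) \<longlonglongrightarrow> u)" for x u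
  have G_I: "G x u" if "(\<lambda>k. P (Y k)) \<longlonglongrightarrow> x - n" "P n = 0" "(\<lambda>k. T (Y k)) \<longlonglongrightarrow> u" for x u Y n
    using that unfolding G_def by (intro exI[of _ Y] exI[of _ n]) simp
  have G_add: "G (x + x') (u + u')" if "G x u" "G x' u'" for x x' u u'
  proof -
    obtain Y n Y' n' where Y: "(\<lambda>k. P (Y k)) \<longlonglongrightarrow> x - n" "P n = 0" "(\<lambda>k. T (Y k)) \<longlonglongrightarrow> u"
      and Y': "(\<lambda>k. P (Y' k)) \<longlonglongrightarrow> x' - n'" "P n' = 0" "(\<lambda>k. T (Y' k)) \<longlonglongrightarrow> u'"
      using \<open>G x u\<close> \<open>G x' u'\<close> unfolding G_def by blast
    have "(\<lambda>k. P (Y k + Y' k)) \<longlonglongrightarrow> x + x' - (n + n')"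
      using tendsto_add[OF Y(1) Y'(1)] by (simp add: P.add algebra_simps)
    moreover have "(\<lambda>k. T (Y k + Y' k)) \<longlonglongrightarrow> u + u'"
      using tendsto_add[OF Y(3) Y'(3)] by (simp add: T.add)
    moreover have "P (n + n') = 0" by (simp add: P.add Y(2) Y'(2))
    ultimately show ?thesis by (intro G_I[where Y = "\<lambda>k. Y k + Y' k" and n = "n + n'"])
  qed
  have G_scaleC: "G (c *\<^sub>C x) (c *\<^sub>C u)" if "G x u" for c x u
  proof -
    obtain Y n where Y: "(\<lambda>k. P (Y k)) \<longlonglongrightarrow> x - n" "P n = 0" "(\<lambda>k. T (Y k)) \<longlonglongrightarrow> u"
      using \<open>G x u\<close> unfolding G_def by blast
    note tend = bounded_linear.tendsto[OF bounded_linear_scaleC, of _ _ _ c]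
    have "(\<lambda>k. P (c *\<^sub>C Y k)) \<longlonglongrightarrow> c *\<^sub>C x - c *\<^sub>C n" "(\<lambda>k. T (c *\<^sub>C Y k)) \<longlonglongrightarrow> c *\<^sub>C u"
      using tend[OF Y(1)] tend[OF Y(3)]
      by (simp_all add: bounded_clinear_scaleC clin T scaleC_diff_right)
    moreover have "P (c *\<^sub>C n) = 0" by (simp add: bounded_clinear_scaleC[OF clin] Y(2) scaleC_zero_right)
    ultimately show ?thesis by (intro G_I[where Y = "\<lambda>k. c *\<^sub>C Y k" and n = "c *\<^sub>C n"])
  qed
  have G_norm: "\<exists>n. P n = 0 \<and> norm u = norm (x - n) \<and> inner (x - n) n = 0" if "G x u" for x u
  proof -
    obtain Y n where Y: "(\<lambda>k. P (Y k)) \<longlonglongrightarrow> x - n" "P n = 0" "(\<lambda>k. T (Y k)) \<longlonglongrightarrow> u"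
      using \<open>G x u\<close> unfolding G_def by blast
    have "norm u = norm (x - n)"
      using tendsto_norm[OF Y(1)] tendsto_norm[OF Y(3)] by (simp add: norm_P LIMSEQ_unique)
    moreover have "x - n \<in> closure (range P)"
      unfolding closure_sequential using Y(1) by (intro exI[of _ "\<lambda>k. P (Y k)"]) simp
    then have "inner (x - n) n = 0"
      using inner_closure_range_kernel[OF P_sym] Y(2) by blast
    ultimately show ?thesis using Y(2) by blast
  qed
  have G_le: "norm u \<le> norm x" if "G x u" for x u
  proof -
    obtain n where n: "norm u = norm (x - n)" "inner (x - n) n = 0"
      using G_norm[OF \<open>G x u\<close>] by blast
    have "(norm x)\<^sup>2 = (norm (x - n))\<^sup>2 + (norm n)\<^sup>2"
      using n(2) by (simp add: power2_norm_eq_inner inner_simps inner_commute)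
    then have "(norm (x - n))\<^sup>2 \<le> (norm x)\<^sup>2" by simp
    then have "norm (x - n) \<le> norm x" by (rule power2_le_imp_le) simp
    then show ?thesis using n(1) by simp
  qed
  have G_ex: "\<exists>u. G x u" for x
  proof -
    obtain q n where q: "q \<in> closure (range P)" "P n = 0" "x = q + n"
      using closure_range_kernel_decomposition[OF P.bounded_linear_axioms P_sym] by blast
    obtain Z where Z: "\<And>k. Z k \<in> range P" "Z \<longlonglongrightarrow> q"
      using q(1) unfolding closure_sequential by blast
    have "\<forall>k. \<exists>y. Z k = P y" using Z(1) by blast
    then obtain Y where Y: "\<And>k. Z k = P (Y k)" by metis
    have "norm (T (Y i) - T (Y j)) = norm (Z i - Z j)" for i j
      by (simp add: Y norm_P flip: T.diff P.diff)
    then have "Cauchy (\<lambda>k. T (Y k))"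
      using LIMSEQ_imp_Cauchy[OF Z(2)] by (simp add: Cauchy_def dist_norm)
    then obtain u where u: "(\<lambda>k. T (Y k)) \<longlonglongrightarrow> u"
      using Cauchy_convergent_iff convergent_def by blast
    have "(\<lambda>k. P (Y k)) \<longlonglongrightarrow> x - n" using Z(2) q(3) by (simp flip: Y)
    from G_I[OF this q(2) u] show ?thesis by blast
  qed
  then obtain U where U: "\<And>x. G x (U x)" by metis
  have U_eq: "U x = u" if "G x u" for x u
  proof -
    \<comment> \<open>Two values at the same \<open>x\<close> differ by a value at 0, which
      \<open>G_le\<close> forces to vanish.\<close>
    have "G (x + (- 1) *\<^sub>C x) (U x + (- 1) *\<^sub>C u)" using U that by (intro G_add G_scaleC)
    from G_le[OF this] show ?thesis by (simp add: scaleC_minus_one)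
  qed
  have "bounded_linear U"
  proof (rule bounded_linear_intro)
    show "U (x + y) = U x + U y" for x y by (intro U_eq G_add U)
    show "U (r *\<^sub>R x) = r *\<^sub>R U x" for r x
      by (rule U_eq) (metis G_scaleC U scaleC_of_real)
    show "norm (U x) \<le> norm x * 1" for x using G_le[OF U] by simp
  qed
  then have "bounded_clinear U" by (rule bounded_clinearI) (intro U_eq G_scaleC U)
  moreover have "U (P x) = T x" for x
    by (intro U_eq G_I[where Y = "\<lambda>_. x" and n = 0]) (simp_all add: P.zero)
  then have "T = U \<circ> P" by auto
  moreover have null: "U x = 0 \<longleftrightarrow> P x = 0" for x
  proof
    assume "U x = 0"
    then show "P x = 0" using G_norm[OF U[of x]] by auto
  next
    assume "P x = 0"
    then show "U x = 0"
      by (intro U_eq G_I[where Y = "\<lambda>_. 0" and n = x]) (simp_all add: P.zero T.zero)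
  qed
  moreover have "norm (U x) = norm x" if "\<forall>y\<in>null_space U. cinner x y = 0" for x
  proof -
    obtain n where n: "P n = 0" "norm (U x) = norm (x - n)" "inner (x - n) n = 0"
      using G_norm[OF U[of x]] by blast
    have "n \<in> null_space U" using n(1) null by (simp add: null_space_def)
    with that have "cinner x n = 0" by blast
    then have "inner x n = 0" by (simp flip: Re_cinner)
    then have "n = 0" using n(3) by (simp add: inner_diff_left)
    then show ?thesis using n(2) by simp
  qed
  moreover have "null_space U = null_space T"
    using null abs_op_eq_zero_iff[OF T] by (simp add: null_space_def P_def)
  ultimately show ?thesis unfolding partial_isometry_def P_def by blast
qed

lemma polar_factor:
  assumes T: "bounded_clinear T"
  shows partial_isometry_polar_factor: "partial_isometry (polar_factor T)"
    and polar_factor_comp_abs_op: "polar_factor T \<circ> abs_op T = T"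
    and null_space_polar_factor: "null_space (polar_factor T) = null_space T"
proof -
  let ?R = "\<lambda>U. partial_isometry U \<and> T = U \<circ> abs_op T \<and> null_space U = null_space T"
  have P: "bounded_linear (abs_op T)" "\<And>x y. inner (abs_op T x) y = inner x (abs_op T y)"
    using positive_op_abs_op[OF T] by (auto simp: positive_op_iff bounded_clinear_def)
  \<comment> \<open>Two candidates agree on the range of \<open>|T|\<close>, hence on its closure,
    and both vanish on the complementary kernel.\<close>
  have uniq: "U = V" if U: "?R U" and V: "?R V" for U V
  proof
    fix x
    obtain q n where q: "q \<in> closure (range (abs_op T))" and n: "abs_op T n = 0" and x: "x = q + n"
      using closure_range_kernel_decomposition[OF P] by blast
    interpret U: bounded_linear U
      using U by (simp add: partial_isometry_def bounded_clinear_def)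
    interpret V: bounded_linear V
      using V by (simp add: partial_isometry_def bounded_clinear_def)
    have "range (abs_op T) \<subseteq> {q. U q = V q}" using U V by (auto simp: fun_eq_iff)
    moreover have "closed {q. U q = V q}"
      by (intro closed_Collect_eq U.continuous_on V.continuous_on continuous_on_id)
    ultimately have "U q = V q" using q closure_minimal by blast
    moreover have "n \<in> null_space T" using n by (simp add: abs_op_eq_zero_iff[OF T] null_space_def)
    then have "U n = 0" "V n = 0" using U V by (auto simp: null_space_def)
    ultimately show "U x = V x" by (simp add: x U.add V.add)
  qed
  have "\<exists>!U. ?R U" using polar_factor_ex[OF T] uniq by blast
  then have "?R (polar_factor T)" unfolding polar_factor_def by (rule theI')
  then show "partial_isometry (polar_factor T)" "polar_factor T \<circ> abs_op T = T"
    "null_space (polar_factor T) = null_space T"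
    by auto
qed

lemma polar_factor_contraction:
  assumes T: "bounded_clinear T"
  shows inner_polar_factor: "inner (T x) (polar_factor T y) = inner (abs_op T x) y"
    and norm_polar_factor_le: "norm (polar_factor T y) \<le> norm y"
proof -
  define U P where "U = polar_factor T" and "P = abs_op T"
  have P: "bounded_linear P" "\<And>x y. inner (P x) y = inner x (P y)"
    using positive_op_abs_op[OF T] by (auto simp: positive_op_iff bounded_clinear_def P_def)
  interpret P: bounded_linear P by (rule P(1))
  interpret U: bounded_linear U
    using partial_isometry_polar_factor[OF T]
    by (simp add: U_def partial_isometry_def bounded_clinear_def)
  have UP: "U (P x) = T x" for x
    using polar_factor_comp_abs_op[OF T] by (simp add: U_def P_def fun_eq_iff)
  have null: "U z = 0 \<longleftrightarrow> P z = 0" for z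
    using null_space_polar_factor[OF T] abs_op_eq_zero_iff[OF T]
    by (auto simp: U_def P_def null_space_def)
  have isom: "norm (U q) = norm q" if q: "q \<in> closure (range P)" for q
  proof -
    \<comment> \<open>The kernel of \<open>P\<close> is stable under \<open>\<i>\<close>, which
      upgrades real orthogonality to complex orthogonality.\<close>
    have "cinner q z = 0" if "z \<in> null_space U" for z
    proof -
      have "P z = 0" using that null by (simp add: null_space_def)
      moreover have "bounded_clinear P"
        using positive_op_abs_op[OF T] by (simp add: positive_op_def P_def)
      ultimately have "P (\<i> *\<^sub>C z) = 0"
        by (simp add: bounded_clinear_scaleC scaleC_zero_right)
      with \<open>P z = 0\<close> inner_closure_range_kernel[OF P(2) q] show ?thesis
        by (simp add: cinner_conv_inner complex_eq_iff)
    qed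
    then show ?thesis
      using partial_isometry_polar_factor[OF T] by (simp add: U_def partial_isometry_def)
  qed
  obtain q n where q: "q \<in> closure (range P)" and n: "P n = 0" and y: "y = q + n"
    using closure_range_kernel_decomposition[OF P] by blast
  have Uy: "U y = U q" using n null by (simp add: y U.add)
  have orth: "inner q n = 0" by (rule inner_closure_range_kernel[OF P(2) q n])
  have "(norm y)\<^sup>2 = (norm q)\<^sup>2 + (norm n)\<^sup>2"
    using orth by (simp add: y power2_norm_eq_inner inner_simps inner_commute)
  then have "(norm q)\<^sup>2 \<le> (norm y)\<^sup>2" by simp
  then have "norm q \<le> norm y" by (rule power2_le_imp_le) simp
  then show "norm (polar_factor T y) \<le> norm y"
    using isom[OF q] Uy by (simp add: U_def)
  have Px: "P x \<in> closure (range P)" by (rule subsetD[OF closure_subset]) simp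
  moreover have "subspace (closure (range P))"
    by (intro subspace_closure linear_subspace_image P.linear_axioms subspace_UNIV)
  ultimately have "P x + q \<in> closure (range P)" using q by (simp add: subspace_add)
  \<comment> \<open>Polarization: isometry on a subspace, applied to a sum, preserves inner products
    there.\<close>
  then have "(norm (U (P x) + U q))\<^sup>2 = (norm (P x + q))\<^sup>2"
    using isom by (simp flip: U.add)
  then have "2 * inner (U (P x)) (U q) + (norm (U (P x)))\<^sup>2 + (norm (U q))\<^sup>2
      = 2 * inner (P x) q + (norm (P x))\<^sup>2 + (norm q)\<^sup>2"
    by (simp add: power2_norm_eq_inner inner_simps inner_commute)
  then have "inner (U (P x)) (U y) = inner (P x) q"
    using isom[OF q] isom[OF Px] Uy by simp
  also have "\<dots> = inner (P x) y" using inner_closure_range_kernel[OF P(2) Px n] by (simp add: y inner_simps)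
  finally show "inner (T x) (polar_factor T y) = inner (abs_op T x) y"
    by (simp add: UP[unfolded U_def P_def] U_def P_def)
qed

subsection \<open>Numerical radius\<close>

lemma bdd_above_numerical_range:
  assumes "bounded_linear A"
  shows "bdd_above (insert 0 {cmod (cinner (A x) x) | x. norm x = 1})"
proof -
  obtain K where K: "\<And>x. norm (A x) \<le> norm x * K"
    using bounded_linear.bounded[OF assms] by blast
  have "cmod (cinner (A x) x) \<le> K" if "norm x = 1" for x
    using cinner_Cauchy_Schwarz[of "A x" x] K[of x] that by simp
  then show ?thesis by (intro bdd_aboveI[of _ "max 0 K"]) (auto simp: max.coboundedI2)
qed

lemma numerical_radius_nonneg: "bounded_linear A \<Longrightarrow> 0 \<le> numerical_radius A"
  unfolding numerical_radius_def by (intro cSup_upper bdd_above_numerical_range) auto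

lemma numerical_radius_le:
  assumes "0 \<le> c" "\<And>x. norm x = 1 \<Longrightarrow> cmod (cinner (A x) x) \<le> c"
  shows "numerical_radius A \<le> c"
  unfolding numerical_radius_def using assms by (intro cSup_least) auto

text \<open>The homogeneous form is needed at vectors such as \<open>U x\<close>, whose norm is only
  known to be at most 1.\<close>

lemma cinner_le_numerical_radius:
  assumes A: "bounded_linear A"
  shows "cmod (cinner (A x) x) \<le> numerical_radius A * (norm x)\<^sup>2"
proof (cases "x = 0")
  case True
  then show ?thesis using cinner_Cauchy_Schwarz[of "A x" x] by simp
next
  case False
  interpret bounded_linear A by fact
  define y where "y = (1 / norm x) *\<^sub>R x"
  have "norm y = 1" using False by (simp add: y_def)
  then have le: "cmod (cinner (A y) y) \<le> numerical_radius A"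
    unfolding numerical_radius_def by (intro cSup_upper bdd_above_numerical_range A) auto
  have x: "x = complex_of_real (norm x) *\<^sub>C y"
    using False by (simp add: y_def scaleC_of_real)
  have "A x = complex_of_real (norm x) *\<^sub>C A y"
    using False by (simp add: y_def scaleC_of_real scaleR)
  then have "cinner (A x) x = complex_of_real ((norm x)\<^sup>2) * cinner (A y) y"
    by (subst (2) x) (simp add: cinner_scaleC_left cinner_scaleC_right power2_eq_square)
  then have "cmod (cinner (A x) x) = (norm x)\<^sup>2 * cmod (cinner (A y) y)"
    by (simp only: norm_mult norm_of_real abs_power2)
  also have "\<dots> \<le> (norm x)\<^sup>2 * numerical_radius A" using le by (simp add: mult_left_mono)
  finally show ?thesis by (simp add: mult.commute)
qed

text \<open>One inequality suffices: for nonzero \<open>c\<close> the reverse one is the same bound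
  for the factor \<open>1 / c\<close>.\<close>

lemma numerical_radius_scaleR:
  assumes "bounded_linear A" "0 \<le> c"
  shows "numerical_radius (\<lambda>x. c *\<^sub>R A x) = c * numerical_radius A"
proof -
  have le: "numerical_radius (\<lambda>x. c *\<^sub>R A x) \<le> c * numerical_radius A"
    if "bounded_linear A" "0 \<le> c" for A :: "'a \<Rightarrow> 'a" and c
  proof (rule numerical_radius_le)
    show "0 \<le> c * numerical_radius A" using that by (simp add: numerical_radius_nonneg)
    fix x :: 'a assume "norm x = 1"
    then show "cmod (cinner (c *\<^sub>R A x) x) \<le> c * numerical_radius A"
      using cinner_le_numerical_radius[OF that(1), of x] that(2)
      by (simp flip: scaleC_of_real add: cinner_scaleC_left norm_mult mult_left_mono)
  qed
  show ?thesis
  proof (cases "c = 0")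
    case True
    then show ?thesis
      using le[OF assms] numerical_radius_nonneg[of "\<lambda>x. c *\<^sub>R A x"] bounded_linear_zero by simp
  next
    case False
    have "numerical_radius (\<lambda>x. (1 / c) *\<^sub>R (c *\<^sub>R A x)) \<le> 1 / c * numerical_radius (\<lambda>x. c *\<^sub>R A x)"
      using assms by (intro le bounded_linear_const_scaleR) auto
    then have "c * numerical_radius A \<le> numerical_radius (\<lambda>x. c *\<^sub>R A x)"
      using False assms(2) by (simp add: field_simps)
    with le[OF assms] show ?thesis by simp
  qed
qed

lemma numerical_radius_add:
  assumes "bounded_linear A" "bounded_linear B"
  shows "numerical_radius (\<lambda>x. A x + B x) \<le> numerical_radius A + numerical_radius B"
proof (rule numerical_radius_le)
  show "0 \<le> numerical_radius A + numerical_radius B"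
    using assms by (simp add: numerical_radius_nonneg)
  fix x :: 'a assume "norm x = 1"
  then show "cmod (cinner (A x + B x) x) \<le> numerical_radius A + numerical_radius B"
    using cinner_le_numerical_radius[OF assms(1), of x] cinner_le_numerical_radius[OF assms(2), of x]
      norm_triangle_ineq[of "cinner (A x) x" "cinner (B x) x"]
    by (simp add: cinner_add_left)
qed

lemma convex_on_numerical_radius:
  assumes L: "\<And>t. bounded_linear (L t)"
    and affine: "\<And>u s t x. L ((1 - u) * s + u * t) x = (1 - u) *\<^sub>R L s x + u *\<^sub>R L t x"
  shows "convex_on UNIV (\<lambda>t. numerical_radius (L t))"
proof (rule convex_onI)
  fix u s t :: real assume u: "0 < u" "u < 1"
  have "L ((1 - u) * s + u * t) = (\<lambda>x. (1 - u) *\<^sub>R L s x + u *\<^sub>R L t x)"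
    using affine by blast
  then have "numerical_radius (L ((1 - u) *\<^sub>R s + u *\<^sub>R t))
      \<le> numerical_radius (\<lambda>x. (1 - u) *\<^sub>R L s x) + numerical_radius (\<lambda>x. u *\<^sub>R L t x)"
    using L by (simp add: numerical_radius_add bounded_linear_const_scaleR)
  then show "numerical_radius (L ((1 - u) *\<^sub>R s + u *\<^sub>R t))
      \<le> (1 - u) * numerical_radius (L s) + u * numerical_radius (L t)"
    using u L by (simp add: numerical_radius_scaleR)
qed simp

text \<open>Since \<open>U\<^sup>*U\<close> is the projection onto the closure of the range of \<open>|T|\<close>, the Duggal
  transform is the compression \<open>U\<^sup>*TU\<close>.\<close>

lemma numerical_radius_duggal_transform_le:
  assumes T: "bounded_clinear T"
  shows "numerical_radius (duggal_transform T) \<le> numerical_radius T"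
proof (rule numerical_radius_le)
  note lin = bounded_clinear_imp_bounded_linear[OF T]
  show nonneg: "0 \<le> numerical_radius T" by (rule numerical_radius_nonneg[OF lin])
  let ?U = "polar_factor T"
  fix x :: 'a assume "norm x = 1"
  have clin: "bounded_clinear ?U"
    using partial_isometry_polar_factor[OF T] by (simp add: partial_isometry_def)
  \<comment> \<open>\<open>inner_polar_factor\<close> at \<open>?U x\<close> gives the real part;
    complex linearity of \<open>?U\<close> moves \<open>\<i>\<close> inside for the imaginary
    part.\<close>
  have "cinner (duggal_transform T x) x = cinner (T (?U x)) (?U x)"
    unfolding cinner_conv_inner bounded_clinear_scaleC[OF clin, symmetric]
    by (simp add: inner_polar_factor[OF T] duggal_transform_def)
  then have "cmod (cinner (duggal_transform T x) x) \<le> numerical_radius T * (norm (?U x))\<^sup>2"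
    using cinner_le_numerical_radius[OF lin] by metis
  also have "\<dots> \<le> numerical_radius T * 1"
    using norm_polar_factor_le[OF T, of x] \<open>norm x = 1\<close> nonneg
    by (intro mult_left_mono) (auto simp: power_le_one)
  finally show "cmod (cinner (duggal_transform T x) x) \<le> numerical_radius T" by simp
qed

lemma bounded_clinear_duggal_transform:
  assumes "bounded_clinear T"
  shows "bounded_clinear (duggal_transform T)"
proof -
  have "bounded_clinear (abs_op T)"
    using positive_op_abs_op[OF assms] by (simp only: positive_op_def)
  moreover have "bounded_clinear (polar_factor T)"
    using partial_isometry_polar_factor[OF assms] by (simp only: partial_isometry_def)
  ultimately show ?thesis unfolding duggal_transform_def by (rule bounded_clinear_compose)
qed

subsection \<open>The Hermite--Hadamard inequality\<close>

text \<open>The lower bound averages \<open>f\<close> with its reflection about 1/2; the upper one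
  puts a chord over each half of the interval.\<close>

lemma Hermite_Hadamard_01:
  fixes f :: "real \<Rightarrow> real"
  assumes f: "convex_on {0..1} f" and cont: "continuous_on {0..1} f"
  shows Hermite_Hadamard_01_left: "f (1/2) \<le> integral {0..1} f"
    and Hermite_Hadamard_01_right: "integral {0..1} f \<le> ((f 0 + f 1) / 2 + f (1/2)) / 2"
proof -
  have int: "f integrable_on {0..1}" using cont by (rule integrable_continuous_interval)
  have "((\<lambda>x. f (-1 *\<^sub>R x + 1)) has_integral integral {0..1} f) {0..1}"
    using has_integral_affinity[of f "integral {0..1} f" 0 1 "-1" 1] int
    by (simp add: has_integral_integral image_affinity_atLeastAtMost)
  then have refl: "((\<lambda>x. f (1 - x)) has_integral integral {0..1} f) {0..1}" by simp
  have avg: "((\<lambda>x. (f x + f (1 - x)) / 2) has_integral (integral {0..1} f + integral {0..1} f) / 2) {0..1}"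
    by (intro has_integral_divide has_integral_add refl integrable_integral int)
  have const: "((\<lambda>x::real. f (1/2)) has_integral f (1/2)) {0..1}"
    using has_integral_const_real[of "f (1/2)" 0 1] by simp
  have "f (1/2) \<le> (f x + f (1 - x)) / 2" if "x \<in> {0..1}" for x
    using convex_onD[OF f, of "1/2" x "1 - x"] that by (simp add: field_simps)
  from has_integral_le[OF const avg this] show "f (1/2) \<le> integral {0..1} f" by simp
  have chord: "integral {a..b} f \<le> (b - a) * (f a + f b) / 2"
    if ab: "0 \<le> a" "a < b" "b \<le> 1" for a b
  proof -
    let ?g = "\<lambda>x. (f b - f a) / (b - a) * (x - a) + f a"
    have "convex_on {a..b} f"
      using f ab by (auto intro: convex_on_subset)
    then have le: "f x \<le> ?g x" if "x \<in> {a..b}" for x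
      using convex_onD_Icc' that by blast
    have "f integrable_on {a..b}"
      using int by (rule integrable_on_subinterval) (use ab in auto)
    then have int_f: "(f has_integral integral {a..b} f) {a..b}" by (rule integrable_integral)
    have int_g: "(?g has_integral (b - a) * (f a + f b) / 2) {a..b}"
    proof -
      have "((\<lambda>x. c * (x - a) + f a) has_integral
          (c * (b - a)\<^sup>2 / 2 + f a * (b - a) - (c * (a - a)\<^sup>2 / 2 + f a * (a - a)))) {a..b}" for c
        using ab
        by (intro fundamental_theorem_of_calculus)
          (auto intro!: derivative_eq_intros simp flip: has_real_derivative_iff_has_vector_derivative)
      moreover have sq: "(f b - f a) / (b - a) * (b - a)\<^sup>2 = (f b - f a) * (b - a)"
        using ab by (simp add: power2_eq_square)
      have "(f b - f a) / (b - a) * (b - a)\<^sup>2 / 2 + f a * (b - a)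
          - ((f b - f a) / (b - a) * (a - a)\<^sup>2 / 2 + f a * (a - a)) = (b - a) * (f a + f b) / 2"
        unfolding sq by (simp add: field_simps)
      ultimately show ?thesis by metis
    qed
    show ?thesis by (rule has_integral_le[OF int_f int_g le])
  qed
  have "integral {0..1} f = integral {0..1/2} f + integral {1/2..1} f"
    by (rule Henstock_Kurzweil_Integration.integral_combine[symmetric]) (use int in auto)
  then show "integral {0..1} f \<le> ((f 0 + f 1) / 2 + f (1/2)) / 2"
    using chord[of 0 "1/2"] chord[of "1/2" 1] by (simp add: field_simps)
qed

theorem theorem4p5:
  fixes T :: "'a::chilbert_space \<Rightarrow> 'a" and l :: real
  assumes "bounded_clinear T" and "l \<in> {0..1}"
  shows "(numerical_radius (lambda_mean_transform l T)
        \<le> 2 * integral {0..1} (\<lambda>t. numerical_radius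
              (\<lambda>x. (l * t) *\<^sub>R T x + ((1 - l) * (1 - t)) *\<^sub>R duggal_transform T x))
      \<and> 2 * integral {0..1} (\<lambda>t. numerical_radius
              (\<lambda>x. (l * t) *\<^sub>R T x + ((1 - l) * (1 - t)) *\<^sub>R duggal_transform T x))
        \<le> 1/2 * (l * numerical_radius T + (1 - l) * numerical_radius (duggal_transform T)
              + numerical_radius (lambda_mean_transform l T)))
    \<and> (numerical_radius (mean_transform T)
        \<le> integral {0..1} (\<lambda>t. numerical_radius (lambda_mean_transform t T))
      \<and> integral {0..1} (\<lambda>t. numerical_radius (lambda_mean_transform t T))
        \<le> 1/4 * (numerical_radius T + numerical_radius (duggal_transform T)
              + 2 * numerical_radius (mean_transform T))
      \<and> 1/4 * (numerical_radius T + numerical_radius (duggal_transform T)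
              + 2 * numerical_radius (mean_transform T))
        \<le> numerical_radius T)"
proof -
  define D where "D = duggal_transform T"
  have T: "bounded_linear T" by (rule bounded_clinear_imp_bounded_linear[OF assms(1)])
  have D: "bounded_linear D"
    unfolding D_def
    by (intro bounded_clinear_imp_bounded_linear bounded_clinear_duggal_transform assms(1))
  have lin: "bounded_linear (\<lambda>x. a *\<^sub>R T x + b *\<^sub>R D x)" for a b
    by (intro bounded_linear_add bounded_linear_const_scaleR T D)
  have HH: "f (1/2) \<le> integral {0..1} f \<and> integral {0..1} f \<le> ((f 0 + f 1) / 2 + f (1/2)) / 2"
    if "convex_on UNIV f" for f :: "real \<Rightarrow> real"
  proof -
    have "continuous_on UNIV f" using that by (intro convex_on_continuous) auto
    then have "continuous_on {0..1} f" by (rule continuous_on_subset) simp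
    moreover have "convex_on {0..1} f" using that by (rule convex_on_subset) auto
    ultimately show ?thesis
      using Hermite_Hadamard_01_left Hermite_Hadamard_01_right by blast
  qed
  define f where "f t = numerical_radius (\<lambda>x. (l * t) *\<^sub>R T x + ((1 - l) * (1 - t)) *\<^sub>R D x)" for t
  have "convex_on UNIV f"
    unfolding f_def by (intro convex_on_numerical_radius lin) (simp add: algebra_simps)
  note HH_f = HH[OF this]
  have "(\<lambda>x. (l * (1/2)) *\<^sub>R T x + ((1 - l) * (1 - 1/2)) *\<^sub>R D x)
      = (\<lambda>x. (1/2) *\<^sub>R lambda_mean_transform l T x)"
    by (simp add: fun_eq_iff lambda_mean_transform_def D_def scaleR_add_right)
  \<comment> \<open>This half is the source of the factor 2 before the first integral.\<close>
  then have f_half: "f (1/2) = numerical_radius (lambda_mean_transform l T) / 2"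
    using lin[of l "1 - l"]
    by (simp add: f_def numerical_radius_scaleR lambda_mean_transform_def D_def)
  have f_0: "f 0 = (1 - l) * numerical_radius D" and f_1: "f 1 = l * numerical_radius T"
    using assms(2) by (simp_all add: f_def numerical_radius_scaleR T D)
  define g where "g t = numerical_radius (lambda_mean_transform t T)" for t
  have "convex_on UNIV g"
    unfolding g_def lambda_mean_transform_def D_def[symmetric]
    by (intro convex_on_numerical_radius lin) (simp add: algebra_simps)
  note HH_g = HH[OF this]
  have g_0: "g 0 = numerical_radius D" and g_1: "g 1 = numerical_radius T"
    by (simp_all add: g_def lambda_mean_transform_def D_def)
  have g_half: "g (1/2) = numerical_radius (mean_transform T)"
    by (simp add: g_def mean_transform_def)
  have "numerical_radius D \<le> numerical_radius T"
    unfolding D_def by (rule numerical_radius_duggal_transform_le[OF assms(1)])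
  \<comment> \<open>Hence the last bound is at most the mean of the radii of \<open>T\<close> and
    \<open>D\<close>, and the radius of \<open>D\<close> does not exceed that of
    \<open>T\<close>.\<close>
  moreover have "g (1/2) \<le> (g 0 + g 1) / 2"
    using convex_onD[OF \<open>convex_on UNIV g\<close>, of "1/2" 0 1] by simp
  ultimately have last: "1/4 * (numerical_radius T + numerical_radius D + 2 * g (1/2)) \<le> numerical_radius T"
    unfolding g_0 g_1 by simp
  show ?thesis
    unfolding D_def[symmetric] f_def[symmetric] g_def[symmetric] g_half[symmetric]
    using HH_f[unfolded f_half f_0 f_1 g_def[symmetric]] HH_g[unfolded g_0 g_1] last
    by (intro conjI; argo)
qed

end
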